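(* Let $C$ be a simple closed curve in the sphere $S^2$, i.e. a subspace of $S^2$ homeomorphic to the circle $S^1$. Then the complement $S^2 \setminus C$ has exactly two components, and each of these components has $C$ as its boundary in $S^2$.
   Context: $S^2$ denotes the standard 2-sphere with its usual topology. "Component" means connected component of the subspace $S^2\setminus C$. "Boundary" means topological boundary in $S^2$. *)

theory Defs
  imports "HOL-Analysis.Analysis"
begin

end

theory Submission
  imports Defs "HOL-Complex_Analysis.Contour_Integration"
begin

text \<open>
  Puncture the sphere at a point \<open>p\<close> off \<open>C\<close> and transport the planar Jordan curve theorem through
  a homeomorphism of the punctured sphere with the plane. The inner domain becomes one component.
  The image of the outer domain together with \<open>p\<close> is the complement of the compact image of the
  curve and its inner domain, hence open; and it is connected because \<open>p\<close> is not isolated in the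
  sphere.
\<close>

text \<open>Each of the two sets is clopen in the union, so no connected subset of the union can
  contain one of them and also meet the other.\<close>

lemma components_Un_separated:
  assumes A: "openin (top_of_set U) A" "connected A" "A \<noteq> {}"
    and B: "openin (top_of_set U) B" "connected B" "B \<noteq> {}"
    and disj: "A \<inter> B = {}"
  shows "components (A \<union> B) = {A, B}"
proof -
  \<comment> \<open>If \<open>D\<close> went beyond \<open>X\<close> it would meet \<open>Y\<close>,
    and the open sets \<open>E\<close> and \<open>F\<close> that cut out \<open>X\<close> and
    \<open>Y\<close> would disconnect it. \<open>X\<close> and \<open>Y\<close> are kept generic so
    that \<open>A\<close> and \<open>B\<close> can take either role.\<close>
  have maximal: "X = D"
    if open_XY: "openin (top_of_set U) X" "openin (top_of_set U) Y"
      and "X \<noteq> {}" "X \<inter> Y = {}" "X \<subseteq> D" "D \<subseteq> X \<union> Y" "connected D" for X Y D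
  proof (rule ccontr)
    assume "X \<noteq> D"
    obtain E F where EF: "open E" "X = U \<inter> E" "open F" "Y = U \<inter> F"
      using open_XY by (auto simp: openin_open)
    have "D \<subseteq> U"
      using that(6) EF by blast
    then have "E \<inter> F \<inter> D = {}" "D \<subseteq> E \<union> F" "E \<inter> D \<noteq> {}" "F \<inter> D \<noteq> {}"
      using that(3-6) EF \<open>X \<noteq> D\<close> by blast+
    then show False
      using connectedD[OF that(7) EF(1,3)] by blast
  qed
  have "A \<in> components (A \<union> B)"
    unfolding in_components_maximal using A maximal[OF A(1) B(1) A(3) disj] by blast
  moreover have "B \<in> components (A \<union> B)"
    unfolding in_components_maximal using B disj maximal[OF B(1) A(1) B(3)] by blast
  ultimately have mem: "A \<in> components (A \<union> B)" "B \<in> components (A \<union> B)" .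
  have "K \<in> {A, B}" if "K \<in> components (A \<union> B)" for K
  proof -
    have "K \<noteq> {}" "K \<subseteq> A \<union> B"
      using that in_components_nonempty in_components_subset by blast+
    \<comment> \<open>\<open>K\<close> meets \<open>A\<close> or \<open>B\<close>, and two
      components that meet coincide.\<close>
    then show ?thesis
      using that mem components_eq[of K "A \<union> B"] by blast
  qed
  with mem show ?thesis
    by blast
qed

text \<open>Bridges from sets to paths: \<open>Jordan_curve\<close> speaks of simple closed paths,
  and such a path arises by running a homeomorphism along \<open>circlepath 0 1\<close>.\<close>

lemma Jordan_curve_homeomorphic_circle:
  fixes J :: "complex set"
  assumes "J homeomorphic sphere (0 :: complex) 1"
  obtains inner outer where
    "inner \<noteq> {}" "open inner" "connected inner"
    "outer \<noteq> {}" "open outer" "connected outer"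
    "bounded inner" "\<not> bounded outer" "inner \<inter> outer = {}"
    "inner \<union> outer = - J" "frontier inner = J" "frontier outer = J"
proof -
  obtain k k' where hom: "homeomorphism (sphere (0 :: complex) 1) J k k'"
    using assms homeomorphic_sym homeomorphic_def by metis
  define c where "c = k \<circ> circlepath 0 1"
  have circle: "path_image (circlepath 0 1) = sphere 0 1"
    by simp
  have "simple_path c"
    unfolding c_def
    by (rule simple_path_continuous_image)
       (use hom in \<open>auto simp: circle simple_path_circlepath homeomorphism_def intro: inj_on_inverseI\<close>)
  moreover have "pathfinish c = pathstart c"
    by (simp add: c_def pathfinish_compose pathstart_compose)
  moreover have "path_image c = J"
    using hom by (simp only: c_def path_image_compose circle homeomorphism_def)
  ultimately show thesis
    using Jordan_curve[of c] that by metis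
qed

text \<open>The complement of \<open>B\<close> in \<open>U\<close> is relatively closed and contains
  \<open>A\<close>, so the relative closure of \<open>A\<close> can add only points of
  \<open>C\<close>; density of \<open>A\<close> at \<open>C\<close> shows that it adds all of
  them.\<close>

lemma frontier_of_openin_eq:
  assumes "openin (top_of_set U) A" "openin (top_of_set U) B" "A \<inter> B = {}"
    and "U - C = A \<union> B" "C \<subseteq> U" "C \<subseteq> closure A" "A \<inter> C = {}"
  shows "(top_of_set U) frontier_of A = C"
proof -
  have AU: "A \<subseteq> U"
    using assms(1) openin_imp_subset by blast
  then have eq: "(top_of_set U) closure_of A = U \<inter> closure A"
    by (simp add: closure_of_subtopology Int_absorb1)
  have "closedin (top_of_set U) (U - B)"
    using assms(2) by (simp add: closedin_diff)
  moreover have "A \<subseteq> U - B"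
    using AU assms(3) by blast
  ultimately have "(top_of_set U) closure_of A \<subseteq> U - B"
    by (simp add: closure_of_minimal)
  then show ?thesis
    using assms eq by (auto simp: frontier_of_openin)
qed

text \<open>Simple connectivity tells the two apart: the 2-sphere has it and the circle does not.
  This supplies the puncture point.\<close>

lemma circle_on_sphere_neq_sphere:
  fixes C :: "'a::euclidean_space set"
  assumes "DIM('a) = 3" "C homeomorphic sphere (0 :: real^2) 1"
  shows "C \<noteq> sphere 0 1"
proof
  assume "C = sphere 0 1"
  then have "simply_connected (sphere (0 :: 'a) 1) = simply_connected (sphere (0 :: real^2) 1)"
    using assms homeomorphic_simply_connected_eq by blast
  then show False
    using assms by (simp add: simply_connected_sphere_eq)
qed

theorem Jordan_curve_sphere:
  fixes C :: "'a::euclidean_space set"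
  assumes dim: "DIM('a) = 3" and CS: "C \<subseteq> sphere 0 1"
    and hom: "C homeomorphic sphere (0 :: real^2) 1"
  obtains A B where "A \<noteq> B" "components (sphere 0 1 - C) = {A, B}"
    "(top_of_set (sphere 0 1)) frontier_of A = C"
    "(top_of_set (sphere 0 1)) frontier_of B = C"
proof -
  let ?S = "sphere (0 :: 'a) 1"
  obtain p where p: "p \<in> ?S" "p \<notin> C"
    using circle_on_sphere_neq_sphere[OF dim hom] CS by blast
  \<comment> \<open>Stereographic projection. The plane is taken to be \<open>complex\<close>, where
    the planar theorem is stated.\<close>
  have "(?S - {p}) homeomorphic (UNIV :: complex set)"
    by (rule homeomorphic_punctured_sphere_affine) (use p dim in auto)
  then obtain f g where fg: "homeomorphism (?S - {p}) (UNIV :: complex set) f g"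
    unfolding homeomorphic_def by blast
  have gf: "g (f x) = x" if "x \<in> ?S - {p}" for x
    using fg that by (simp add: homeomorphism_def)
  have cont_g: "continuous_on X g" for X
    using homeomorphism_cont2[OF fg] continuous_on_subset by blast
  have g_im: "g ` UNIV = ?S - {p}"
    using fg by (simp add: homeomorphism_def)
  have inj_g: "inj g"
    using fg by (intro inj_on_inverseI[of _ f]) (auto simp: homeomorphism_def)
  define J where "J = f ` C"
  have gJ: "g ` J = C"
    unfolding J_def image_image using gf CS p by (force simp: image_iff)
  have "homeomorphism C J f g"
    using homeomorphism_of_subsets[OF fg, of C J] CS p by (auto simp: J_def)
  then have "J homeomorphic C"
    using homeomorphic_sym homeomorphic_def by blast
  also note hom
  also have "sphere (0 :: real^2) 1 homeomorphic sphere (0 :: complex) 1"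
    by (rule homeomorphic_spheres_gen) auto
  finally have J_circle: "J homeomorphic sphere (0 :: complex) 1" .
  obtain inner outer where io:
    "inner \<noteq> {}" "open inner" "connected inner"
    "outer \<noteq> {}" "open outer" "connected outer"
    "bounded inner" "\<not> bounded outer" "inner \<inter> outer = {}"
    "inner \<union> outer = - J" "frontier inner = J" "frontier outer = J"
    using Jordan_curve_homeomorphic_circle[OF J_circle] .
  define A where "A = g ` inner"
  define B where "B = insert p (g ` outer)"
  \<comment> \<open>Here the boundedness of \<open>inner\<close> matters: it keeps the image closed
    in the whole sphere, hence away from \<open>p\<close>.\<close>
  have compact_hull: "compact (g ` (J \<union> inner))"
  proof -
    have "J \<union> inner = closure inner"
      using io closure_Un_frontier by blast
    then have "compact (J \<union> inner)"
      using \<open>bounded inner\<close> by simp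
    then show ?thesis
      using cont_g compact_continuous_image by blast
  qed
  have split_UNIV: "UNIV = J \<union> inner \<union> outer" "J \<inter> inner = {}" "J \<inter> outer = {}"
    using io(10) by auto
  have split_S: "?S - {p} = C \<union> A \<union> g ` outer"
    unfolding gJ[symmetric] A_def g_im[symmetric] image_Un[symmetric] using split_UNIV(1) by simp
  have disj: "C \<inter> A = {}" "C \<inter> g ` outer = {}" "A \<inter> g ` outer = {}"
    using split_UNIV io(9) inj_g
    unfolding gJ[symmetric] A_def by (simp_all add: image_Int[symmetric])
  have p_notin: "p \<notin> A"
    using split_S by blast
  have SC: "?S - C = A \<union> B"
    unfolding B_def using split_S disj p by blast
  have AB: "A \<inter> B = {}"
    unfolding B_def using disj p_notin by auto
  have open_A: "openin (top_of_set ?S) A"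
  proof -
    have "openin (top_of_set (?S - {p})) (g ` inner)"
      by (rule homeomorphism_imp_open_map[OF homeomorphism_symD[OF fg]])
         (use io in auto)
    \<comment> \<open>The punctured sphere is itself open in the sphere, so relative openness
      carries over.\<close>
    then show ?thesis
      unfolding A_def using openin_delete openin_subtopology_self openin_trans by blast
  qed
  have open_B: "openin (top_of_set ?S) B"
  proof -
    have "B = ?S - g ` (J \<union> inner)"
      using SC AB CS disj(1) p unfolding image_Un gJ A_def[symmetric] by blast
    moreover have "g ` (J \<union> inner) \<subseteq> ?S"
      using g_im by blast
    ultimately show ?thesis
      using compact_hull compact_imp_closed closed_subset openin_diff openin_subtopology_self
      by metis
  qed
  have conn_A: "connected A"
    unfolding A_def using cont_g io connected_continuous_image by blast
  have conn_B: "connected B"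
  proof (rule connected_intermediate_closure)
    show "connected (g ` outer)"
      using cont_g io connected_continuous_image by blast
    show "g ` outer \<subseteq> B"
      unfolding B_def by blast
    have "connected ?S"
      using dim by (intro connected_sphere) simp
    moreover have "?S \<noteq> {x}" for x
    proof
      assume "?S = {x}"
      with p(1) have "?S - {p} = {}"
        by auto
      with g_im show False
        by simp
    qed
    ultimately have "p islimpt ?S"
      using connected_imp_perfect[OF _ p(1)] by blast
    moreover obtain T where T: "open T" "B = ?S \<inter> T"
      using open_B openin_open by blast
    moreover have "p \<in> T"
      using T(2) B_def by blast
    \<comment> \<open>Within the neighbourhood \<open>T\<close> of \<open>p\<close> the set
      \<open>B\<close> agrees with the sphere, so \<open>p\<close> remains a limit point; dropping
      \<open>p\<close> itself from \<open>B\<close> does not change that.\<close>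
    ultimately have "p islimpt B"
      by (auto intro!: islimpt_Int_eventually eventually_at_in_open')
    then have "p islimpt g ` outer"
      by (simp add: B_def islimpt_insert)
    then show "B \<subseteq> closure (g ` outer)"
      unfolding B_def using closure_subset by (auto simp: closure_def)
  qed
  \<comment> \<open>Continuity of \<open>g\<close> carries the planar boundary into the closure of
    the image. For \<open>B\<close>, the closure then only grows when \<open>p\<close> is
    added.\<close>
  have clo: "C \<subseteq> closure (g ` X)" if "frontier X = J" for X
  proof -
    have "g ` J \<subseteq> g ` closure X"
      using that by (auto simp: frontier_def)
    also have "\<dots> \<subseteq> closure (g ` X)"
      by (rule continuous_image_closure_subset[OF cont_g order_refl])
    finally show ?thesis
      using gJ by simp
  qed
  have C_A: "C \<subseteq> closure A"
    unfolding A_def using clo io by blast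
  have C_B: "C \<subseteq> closure B"
    using clo[of outer] io closure_mono[of "g ` outer" B] unfolding B_def by blast
  have ne: "A \<noteq> {}" "B \<noteq> {}"
    using io unfolding A_def B_def by auto
  show thesis
  proof
    show "A \<noteq> B"
      using AB ne by blast
    show "components (?S - C) = {A, B}"
      unfolding SC by (rule components_Un_separated[OF open_A conn_A ne(1) open_B conn_B ne(2) AB])
    show "(top_of_set ?S) frontier_of A = C"
      by (rule frontier_of_openin_eq[OF open_A open_B AB SC CS C_A]) (use disj in blast)
    show "(top_of_set ?S) frontier_of B = C"
      by (rule frontier_of_openin_eq[OF open_B open_A _ _ CS C_B]) (use SC AB in blast)+
  qed
qed

theorem theorem5p2:
  fixes C :: "(real^3) set"
  assumes "C \<subseteq> sphere 0 1"
    and "C homeomorphic sphere (0 :: real^2) 1"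
  shows "card (components (sphere 0 1 - C)) = 2 \<and>
    (\<forall>K \<in> components (sphere 0 1 - C). (top_of_set (sphere 0 1)) frontier_of K = C)"
proof -
  have "DIM(real^3) = 3"
    by simp
  from Jordan_curve_sphere[OF this assms] show ?thesis
    by (smt (verit) card_2_iff insertE singletonD)
qed

end
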